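(* For each approximating number $q\in(1/2,1)$, the Soup Division Problem $SDP(q)$ has a boundedly fair division.
   Context: Let $0<q<1$. A sequence of signs is a sequence $( *_i)_{i\ge 1}$ with each $*_i\in\{+,-\}$; write $*_i a$ for $+a$ or $-a$ accordingly. A sequence of signs $( *_i)_{i\ge1}$ is an asymptotically fair division for $SDP(q)$ if $\sum_{i=1}^n *_i 1=o(n)$ as $n\to\infty$ and $\lim_{n\to\infty}\sum_{i=1}^n *_i q^i=0$. It is a boundedly fair division for $SDP(q)$ if it is an asymptotically fair division for $SDP(q)$ and moreover $\sum_{i=1}^n *_i 1=O(1)$ (i.e. these partial sums are bounded uniformly in $n$). A balanced $\pm$-polynomial is a polynomial $P(x)$ of the form $\sum_{i=1}^n \pm x^i$ with $n\ge 1$ (each coefficient of $x^1,\dots,x^n$ is $+1$ or $-1$, and the constant term is $0$) such that $P(1)=0$; its degree is $n$. A number $q\in(1/2,1)$ is approximating if there exist non-negative numbers $A$ and $N$ such that for each $x_0\in[0,A]$ there exists a balanced $\pm$-polynomial $P$ of degree $n\le N$ such that $|x_0-P(q)|\le Aq^n$. *)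

theory Defs
  imports
    Complex_Main
    "HOL-Library.Landau_Symbols"
    "HOL-Computational_Algebra.Polynomial"
begin

text \<open>Signs are the reals \<open>1\<close> and \<open>-1\<close>. Sequences are indexed from \<open>1\<close>; the value at
  index \<open>0\<close> is unconstrained and never used.\<close>

definition sign_sequence :: "(nat \<Rightarrow> real) \<Rightarrow> bool" where
  "sign_sequence s \<longleftrightarrow> (\<forall>i\<ge>1. s i \<in> {1, -1})"

definition asymptotically_fair_division :: "real \<Rightarrow> (nat \<Rightarrow> real) \<Rightarrow> bool" where
  "asymptotically_fair_division q s \<longleftrightarrow>
     sign_sequence s \<and>
     (\<lambda>n. \<Sum>i=1..n. s i) \<in> o(\<lambda>n. real n) \<and>
     (\<lambda>n. \<Sum>i=1..n. s i * q ^ i) \<longlonglongrightarrow> 0"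

definition boundedly_fair_division :: "real \<Rightarrow> (nat \<Rightarrow> real) \<Rightarrow> bool" where
  "boundedly_fair_division q s \<longleftrightarrow>
     asymptotically_fair_division q s \<and>
     (\<lambda>n. \<Sum>i=1..n. s i) \<in> O(\<lambda>_. 1)"

definition balanced_pm_poly :: "real poly \<Rightarrow> bool" where
  "balanced_pm_poly P \<longleftrightarrow>
     degree P \<ge> 1 \<and>
     coeff P 0 = 0 \<and>
     (\<forall>i\<in>{1..degree P}. coeff P i \<in> {1, -1}) \<and>
     poly P 1 = 0"

definition approximating :: "real \<Rightarrow> bool" where
  "approximating q \<longleftrightarrow>
     q \<in> {1/2<..<1} \<and>
     (\<exists>A N :: real. A \<ge> 0 \<and> N \<ge> 0 \<and>
        (\<forall>x\<^sub>0\<in>{0..A}. \<exists>P. balanced_pm_poly P \<and> real (degree P) \<le> N \<and>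
           \<bar>x\<^sub>0 - poly P q\<bar> \<le> A * q ^ degree P))"

end

theory Submission
  imports Defs
begin

text \<open>
  A division is built by always cancelling the error made so far. If the signs up to \<open>n\<close> have
  weighted sum \<open>\<Sum>i=1..n. s i * q ^ i\<close> equal to \<open>- q\<^sup>n y\<close>, the signs still to come must
  contribute \<open>y\<close> after rescaling by \<open>q\<^sup>n\<close>.
  As long as \<open>\<bar>y\<bar> \<le> A\<close>, the approximation property (extended to negative targets by flipping
  signs) offers a block of at most \<open>N\<close> signs with total zero that leaves, after rescaling by the
  length of the block, again a target of absolute value at most \<open>A\<close>. So blocks can be
  concatenated forever, starting with the target \<open>0\<close>.

  At the ends of blocks the sign sums vanish; inside a block they stay within \<open>N\<close>. The rescaled
  targets are bounded too, by \<open>A\<close> at the ends of blocks and by \<open>A + N\<close> inside them, so the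
  weighted sum \<open>- q\<^sup>n y\<close> tends to \<open>0\<close>.

  To avoid the bookkeeping of block boundaries, the process consumes one sign at a time. Its state
  is a pair of the current target \<open>y\<close> and the list \<open>l\<close> of signs of the current block that are not
  yet used. For a list \<open>l\<close> of signs, \<open>q * poly (Poly l) q\<close> is its contribution to the weighted sum:
  the first sign has weight \<open>q\<close>, hence the additional factor. The invariant \<open>good_state\<close> says that
  the pending signs will bring the target back into \<open>[-A, A]\<close>; the lemmas \<open>good_state_step\<close> and
  \<open>good_state_target_bounded\<close> carry the proof.
\<close>

definition good_state :: "real \<Rightarrow> real \<Rightarrow> nat \<Rightarrow> real \<times> real list \<Rightarrow> bool" where
  "good_state q A N = (\<lambda>(y, l). set l \<subseteq> {1, -1} \<and> length l \<le> N \<and>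
     \<bar>y - q * poly (Poly l) q\<bar> \<le> A * q ^ length l)"

lemma poly_Poly_1_eq_sum_list: "poly (Poly l) (1 :: 'a :: comm_semiring_1) = sum_list l"
  by (induction l) auto

lemma balanced_pm_poly_uminus:
  assumes "balanced_pm_poly P"
  shows "balanced_pm_poly (- P)"
  using assms unfolding balanced_pm_poly_def by force

lemma balanced_pm_poly_imp_sign_list:
  assumes "balanced_pm_poly P"
  obtains l where "l \<noteq> []" "set l \<subseteq> {1, -1}" "sum_list l = 0" "length l = degree P"
    "\<And>x. x * poly (Poly l) x = poly P x"
proof -
  obtain a R where P: "P = pCons a R" by (cases P)
  have a: "a = 0" and deg: "degree P \<ge> 1" and sgn: "\<forall>i\<in>{1..degree P}. coeff P i \<in> {1, -1}"
    and bal: "poly P 1 = 0"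
    using assms P by (auto simp: balanced_pm_poly_def)
  have R: "R \<noteq> 0" using deg P by auto
  hence dP: "degree P = Suc (degree R)" using P by simp
  show ?thesis
  proof
    show "coeffs R \<noteq> []" using R by simp
    show "length (coeffs R) = degree P" using R dP by (simp add: length_coeffs_degree)
    show "x * poly (Poly (coeffs R)) x = poly P x" for x using P a by simp
    show "sum_list (coeffs R) = 0"
      using bal P a by (simp flip: poly_Poly_1_eq_sum_list)
    show "set (coeffs R) \<subseteq> {1, -1}"
    proof
      fix c assume "c \<in> set (coeffs R)"
      then obtain i where "i < length (coeffs R)" "c = coeffs R ! i"
        by (auto simp: in_set_conv_nth)
      hence "i \<le> degree R" "c = coeff P (Suc i)"
        using P R by (auto simp: length_coeffs_degree coeffs_nth)
      thus "c \<in> {1, -1}" using sgn dP by auto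
    qed
  qed
qed

lemma approximating_imp_sign_blocks:
  assumes "approximating q"
  obtains A N where "A \<ge> 0"
    "\<And>y. \<bar>y\<bar> \<le> A \<Longrightarrow> \<exists>l. l \<noteq> [] \<and> sum_list l = 0 \<and> good_state q A N (y, l)"
proof -
  obtain A M :: real where A: "A \<ge> 0" and
    approx: "\<And>x. x \<in> {0..A} \<Longrightarrow>
      \<exists>P. balanced_pm_poly P \<and> real (degree P) \<le> M \<and> \<bar>x - poly P q\<bar> \<le> A * q ^ degree P"
    using assms unfolding approximating_def by blast
  have "\<exists>l. l \<noteq> [] \<and> sum_list l = 0 \<and> good_state q A (nat \<lfloor>M\<rfloor>) (y, l)" if y: "\<bar>y\<bar> \<le> A" for y
  proof -
    obtain P where P: "balanced_pm_poly P" "real (degree P) \<le> M"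
      "\<bar>y - poly P q\<bar> \<le> A * q ^ degree P"
    proof (cases "y \<ge> 0")
      case True
      thus ?thesis using approx[of y] y that by auto
    next
      case False
      then obtain P where P: "balanced_pm_poly P" "real (degree P) \<le> M"
        "\<bar>- y - poly P q\<bar> \<le> A * q ^ degree P"
        using approx[of "- y"] y by auto
      show ?thesis
        by (rule that[of "- P"]) (use P balanced_pm_poly_uminus in auto)
    qed
    obtain l where l: "l \<noteq> []" "set l \<subseteq> {1, -1}" "sum_list l = 0" "length l = degree P"
      "\<And>x. x * poly (Poly l) x = poly P x"
      using balanced_pm_poly_imp_sign_list[OF P(1)] by blast
    have "length l \<le> nat \<lfloor>M\<rfloor>" using P(2) l(4) by (simp add: le_nat_floor)
    thus ?thesis using l P(3) unfolding good_state_def by auto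
  qed
  with A show ?thesis by (rule that)
qed

text \<open>
  When no signs are pending, the target lies in \<open>[-A, A]\<close> and a new block is started. Because a
  block has total zero, the sum of pending signs obeys the same recurrence whether or not the step
  starts a block, and no case distinction survives in the conclusion.
\<close>

lemma good_state_step:
  assumes q: "q > 0"
    and blocks: "\<And>y. \<bar>y\<bar> \<le> A \<Longrightarrow> \<exists>l. l \<noteq> [] \<and> sum_list l = 0 \<and> good_state q A N (y, l)"
    and good: "good_state q A N (y, l)"
  shows "\<exists>y' l' e. good_state q A N (y', l') \<and> e \<in> {1, -1} \<and>
           y = q * (e + y') \<and> sum_list l = e + sum_list l'"
proof -
  obtain m where m: "m \<noteq> []" "sum_list m = sum_list l" "good_state q A N (y, m)"
  proof (cases "l = []")
    case True
    hence "\<bar>y\<bar> \<le> A" using good by (simp add: good_state_def)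
    thus ?thesis using blocks that True by fastforce
  qed (use that good in blast)
  then obtain e l' where el: "m = e # l'" by (cases m) auto
  define y' where "y' = y / q - e"
  have y: "y = q * (e + y')" using q by (simp add: y'_def)
  have "q * \<bar>y' - q * poly (Poly l') q\<bar> = \<bar>q * (y' - q * poly (Poly l') q)\<bar>"
    using q by (simp add: abs_mult)
  also have "\<dots> = \<bar>y - q * poly (Poly m) q\<bar>" by (simp add: el y algebra_simps)
  also have "\<dots> \<le> q * (A * q ^ length l')"
    using m(3) el by (simp add: good_state_def mult.left_commute)
  finally have "\<bar>y' - q * poly (Poly l') q\<bar> \<le> A * q ^ length l'" using q by simp
  hence "good_state q A N (y', l')" and "e \<in> {1, -1}"
    using m(3) el by (auto simp: good_state_def)
  moreover have "sum_list l = e + sum_list l'" using m(2) el by simp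
  ultimately show ?thesis using y by blast
qed

lemma abs_poly_Poly_signs_le:
  fixes q :: real
  assumes "set l \<subseteq> {1, -1}" "0 \<le> q" "q \<le> 1"
  shows "\<bar>poly (Poly l) q\<bar> \<le> length l"
  using assms(1)
proof (induction l)
  case (Cons e l)
  have "\<bar>poly (Poly (e # l)) q\<bar> \<le> \<bar>e\<bar> + \<bar>q * poly (Poly l) q\<bar>" by simp
  also have "\<bar>q * poly (Poly l) q\<bar> \<le> \<bar>poly (Poly l) q\<bar>"
    using assms(2,3) by (simp add: abs_mult mult_left_le_one_le)
  also have "\<bar>e\<bar> = 1" using Cons.prems by auto
  finally show ?case using Cons by auto
qed simp

lemma good_state_pending_bounded:
  assumes "good_state q A N (y, l)"
  shows "\<bar>sum_list l\<bar> \<le> N"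
  using assms abs_poly_Poly_signs_le[of l 1]
  by (auto simp: good_state_def poly_Poly_1_eq_sum_list)

lemma good_state_target_bounded:
  assumes "good_state q A N (y, l)" "0 \<le> q" "q \<le> 1" "A \<ge> 0"
  shows "\<bar>y\<bar> \<le> A + N"
proof -
  have "\<bar>y - q * poly (Poly l) q\<bar> \<le> A * q ^ length l"
    using assms(1) by (simp add: good_state_def)
  also have "\<dots> \<le> A" using assms(2-4) by (simp add: mult_left_le power_le_one)
  finally have "\<bar>y - q * poly (Poly l) q\<bar> \<le> A" .
  moreover have "\<bar>q * poly (Poly l) q\<bar> \<le> \<bar>poly (Poly l) q\<bar>"
    using assms(2,3) by (simp add: abs_mult mult_left_le_one_le)
  moreover have "\<bar>poly (Poly l) q\<bar> \<le> N"
    using assms(1) abs_poly_Poly_signs_le[OF _ assms(2,3), of l] by (auto simp: good_state_def)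
  ultimately show ?thesis by linarith
qed

theorem proposition5:
  fixes q :: real
  assumes "q \<in> {1/2<..<1}" and "approximating q"
  shows "\<exists>s. boundedly_fair_division q s"
proof -
  have q: "0 < q" "q < 1" using assms(1) by auto
  obtain A N where A: "A \<ge> 0" and
    blocks: "\<And>y. \<bar>y\<bar> \<le> A \<Longrightarrow> \<exists>l. l \<noteq> [] \<and> sum_list l = 0 \<and> good_state q A N (y, l)"
    using approximating_imp_sign_blocks[OF assms(2)] by blast

  obtain st where good: "\<And>n. good_state q A N (st n)" and st0: "st 0 = (0, [])"
    and step: "\<And>n. \<exists>e\<in>{1, -1}. fst (st n) = q * (e + fst (st (Suc n))) \<and>
                  sum_list (snd (st n)) = e + sum_list (snd (st (Suc n)))"
  proof -
    have "\<exists>st. \<forall>n. (good_state q A N (st n) \<and> (n = 0 \<longrightarrow> st n = (0, []))) \<and>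
            (\<exists>e\<in>{1, -1}. fst (st n) = q * (e + fst (st (Suc n))) \<and>
              sum_list (snd (st n)) = e + sum_list (snd (st (Suc n))))"
    proof (rule dependent_nat_choice)
      show "\<exists>x. good_state q A N x \<and> (0 = (0::nat) \<longrightarrow> x = (0, []))"
        using A by (simp add: good_state_def)
    next
      fix x and n :: nat
      assume "good_state q A N x \<and> (n = 0 \<longrightarrow> x = (0, []))"
      hence "good_state q A N (fst x, snd x)" by simp
      from good_state_step[OF q(1) blocks this]
      show "\<exists>x'. (good_state q A N x' \<and> (Suc n = 0 \<longrightarrow> x' = (0, []))) \<and>
              (\<exists>e\<in>{1, -1}. fst x = q * (e + fst x') \<and>
                sum_list (snd x) = e + sum_list (snd x'))"
        by fastforce
    qed
    thus ?thesis using that by blast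
  qed
  define y where "y n = fst (st n)" for n
  define r where "r n = sum_list (snd (st n))" for n
  obtain e where e: "\<And>n. e n \<in> {1, -1}" "\<And>n. y n = q * (e n + y (Suc n))"
    "\<And>n. r n = e n + r (Suc n)"
    using step unfolding y_def r_def by metis
  \<comment> \<open>The sign emitted by the step from state \<open>n\<close> to state \<open>n + 1\<close> is the sign with index \<open>n + 1\<close>.\<close>
  define s where "s i = e (i - 1)" for i

  \<comment> \<open>Both recurrences of the run telescope from the initial state, where the target and the
    pending sum are \<open>0\<close>.\<close>
  have sum_s: "(\<Sum>i=1..n. s i) = - r n" for n
  proof (induction n)
    case 0
    show ?case by (simp add: r_def st0)
  next
    case (Suc n)
    thus ?case using e(3)[of n] by (simp add: s_def)
  qed
  have sum_sq: "(\<Sum>i=1..n. s i * q ^ i) = - (q ^ n * y n)" for n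
  proof (induction n)
    case 0
    show ?case by (simp add: y_def st0)
  next
    case (Suc n)
    thus ?case using e(2)[of n] by (simp add: s_def algebra_simps)
  qed
  have y_bound: "\<bar>y n\<bar> \<le> A + N" and r_bound: "\<bar>r n\<bar> \<le> N" for n
    using good_state_target_bounded[of q A N "y n" "snd (st n)"]
      good_state_pending_bounded[of q A N "y n" "snd (st n)"] good[of n] q A
    by (simp_all add: y_def r_def)

  have bounded: "(\<lambda>n. \<Sum>i=1..n. s i) \<in> O(\<lambda>_. 1)"
    unfolding sum_s by (rule bigoI[of _ "real N"]) (use r_bound in simp)
  have "(\<lambda>_. 1) \<in> o(\<lambda>n. real n)"
    by (rule smalloI_tendsto) (auto simp: lim_inverse_n' eventually_sequentially intro!: exI[of _ 1])
  with bounded have small: "(\<lambda>n. \<Sum>i=1..n. s i) \<in> o(\<lambda>n. real n)"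
    by (rule landau_o.big_small_trans)
  have "(\<lambda>n. q ^ n * y n) \<longlonglongrightarrow> 0"
  proof (rule tendsto_0_le[where K = "A + N"])
    show "(\<lambda>n. q ^ n) \<longlonglongrightarrow> 0" using q by (intro LIMSEQ_power_zero) simp
    show "\<forall>\<^sub>F n in sequentially. norm (q ^ n * y n) \<le> norm (q ^ n) * (A + N)"
      using y_bound q by (intro always_eventually) (auto simp: abs_mult intro!: mult_left_mono)
  qed
  hence "(\<lambda>n. \<Sum>i=1..n. s i * q ^ i) \<longlonglongrightarrow> 0"
    unfolding sum_sq using tendsto_minus by fastforce
  moreover have "sign_sequence s" using e(1) by (simp add: sign_sequence_def s_def)
  ultimately have "boundedly_fair_division q s"
    using bounded small
    unfolding boundedly_fair_division_def asymptotically_fair_division_def by simp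
  thus ?thesis by (rule exI[of _ s])
qed

end
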